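(* Consider a single-species model ($r=1$, $\vec\lambda=(1)$, $\vec h=(h)$ with $h\ge0$, $\xi$ a univariate function). If $\xi'(1)+h^2\ge\xi''(1)$, then $$\mathsf{ALG}=(\xi'(1)+h^2)^{1/2},$$ and the variational formula defining $\mathsf{ALG}$ is maximized at $q_0=\frac{h^2}{\xi'(1)+h^2}$, $p(q)=\frac{q(\xi'(1)+h^2)-h^2}{\xi'(q)}$ for $q\in[q_0,1]$. Otherwise there is a unique $q_1\in[0,1)$ satisfying $\xi'(q_1)+h^2=q_1\xi''(q_1)$, and $$\mathsf{ALG}=q_1\xi''(q_1)^{1/2}+\int_{q_1}^1\xi''(q)^{1/2}\,dq;$$ the variational formula is then maximized at $$q_0=\frac{h^2}{\xi''(q_1)},\qquad p(q)=\begin{cases}\dfrac{q\,\xi''(q_1)-h^2}{\xi'(q)}&q\in[q_0,q_1],\\[1ex]1&q\in[q_1,1].\end{cases}$$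
   Context: Single-species setting: $\xi(x)=\sum_{k\ge2}\gamma_k^2x^k$ with $\gamma_k\ge0$ and $\sum_{k\ge2}2^k\gamma_k<\infty$, and $h\ge0$. For $0\le q_0\le1$, $\mathbb I(q_0,1)$ is the set of increasing (i.e. nondecreasing), continuously differentiable functions $[q_0,1]\to[0,1]$. The general algorithmic functional involves also an admissible path $\Phi$, but with one species admissibility forces $\Phi(q)=q$, so $$\mathsf{ALG}=\sup_{q_0\in[0,1]}\ \sup_{p\in\mathbb I(q_0,1)}\Big[h\sqrt{q_0}+\int_{q_0}^1\sqrt{(p\,\xi')'(q)}\,dq\Big],\qquad(p\,\xi')(q)=p(q)\xi'(q).$$ Conventions: quotients of the form $0/0$ are interpreted as $0$ in the formula for $q_0$, and by continuous extension in the formula for $p$; if $q_0=q_1=0$ then $p\equiv1$. *)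

theory Defs
  imports "HOL-Analysis.Analysis"
begin

text \<open>The sum is shifted so that it starts at the quadratic term; \<open>\<gamma> 0\<close> and \<open>\<gamma> 1\<close> are never used.\<close>

definition mixture :: "(nat \<Rightarrow> real) \<Rightarrow> real \<Rightarrow> real" where
  "mixture \<gamma> x = (\<Sum>k. (\<gamma> (k + 2))\<^sup>2 * x ^ (k + 2))"

text \<open>Only the values of \<open>p\<close> on \<open>{a..b}\<close> matter: derivatives are one-sided at the endpoints.\<close>

definition incr_C1 :: "real \<Rightarrow> real \<Rightarrow> (real \<Rightarrow> real) set" where
  "incr_C1 a b = {p. p ` {a..b} \<subseteq> {0..1} \<and> mono_on {a..b} p \<and>
     (\<exists>p'. continuous_on {a..b} p' \<and>
       (\<forall>q\<in>{a..b}. (p has_real_derivative p' q) (at q within {a..b})))}"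

definition alg_functional :: "real \<Rightarrow> (real \<Rightarrow> real) \<Rightarrow> real \<Rightarrow> (real \<Rightarrow> real) \<Rightarrow> real" where
  "alg_functional h \<xi> q0 p = h * sqrt q0 +
     integral {q0..1} (\<lambda>q. sqrt (vector_derivative (\<lambda>s. p s * deriv \<xi> s) (at q within {q0..1})))"

text \<open>The supremum is taken in the extended reals, so that finiteness is not built in.\<close>

definition ALG :: "real \<Rightarrow> (real \<Rightarrow> real) \<Rightarrow> ereal" where
  "ALG h \<xi> = (SUP q0\<in>{0..1}. SUP p\<in>incr_C1 q0 1. ereal (alg_functional h \<xi> q0 p))"

definition ALG_maximized_at :: "real \<Rightarrow> (real \<Rightarrow> real) \<Rightarrow> real \<Rightarrow> (real \<Rightarrow> real) \<Rightarrow> bool" where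
  "ALG_maximized_at h \<xi> q0 p \<longleftrightarrow>
     is_arg_max (\<lambda>(q, f). alg_functional h \<xi> q f) (\<lambda>(q, f). q \<in> {0..1} \<and> f \<in> incr_C1 q 1) (q0, p)"

text \<open>A quotient extended by continuity to the zeros of its denominator.  For the derivative of a
  mixture as denominator, such a zero in \<open>{0..1}\<close> is \<open>0\<close>, unless the mixture vanishes identically;
  in that last case there is nothing to extend, and the value is \<open>0\<close> (as \<open>x / 0 = 0\<close>).\<close>

definition ext_quotient :: "(real \<Rightarrow> real) \<Rightarrow> (real \<Rightarrow> real) \<Rightarrow> real \<Rightarrow> real" where
  "ext_quotient f g q =
     (if g q \<noteq> 0 then f q / g q else Lim (at_right q) (\<lambda>s. f s / g s))"

end

theory Submission
  imports Defs
begin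

text \<open>
  The upper bound is a duality argument. For a weight \<open>w > 0\<close> the arithmetic-geometric mean
  inequality gives \<open>2 * sqrt ((p \<xi>')') \<le> w * (p \<xi>')' + 1 / w\<close> and
  \<open>2 * h * sqrt q\<^sub>0 \<le> h\<^sup>2 * w 0 + q\<^sub>0 / w 0\<close>. Let \<open>w = 1 / sqrt B\<close> with \<open>B\<close> positive, continuous and
  nondecreasing. As \<open>w\<close> decreases, replacing \<open>p\<close> by \<open>1\<close> and \<open>q\<^sub>0\<close> by \<open>0\<close> can only
  increase the result, and so every admissible pair has value at most
  \<open>(h\<^sup>2 / sqrt (B 0) + \<integral>\<^sub>0\<^sup>1 (sqrt B + \<xi>'' / sqrt B)) / 2\<close>; this is \<open>alg_functional_le\<close>. The
  comparison of \<open>p\<close> with \<open>1\<close> is an integration by parts for \<open>u = (1 - p) * \<xi>'\<close>, done with the second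
  mean value theorem, so that \<open>w\<close> need not be differentiable.

  In the first regime \<open>B\<close> is the constant \<open>A = \<xi>' 1 + h\<^sup>2\<close>; in the second,
  \<open>B q = \<xi>'' (max q q\<^sub>1)\<close>, for which the equation of \<open>q\<^sub>1\<close> makes the two halves of the bound equal.
  These choices may vanish somewhere: the constant is therefore perturbed to \<open>A + \<epsilon>\<^sup>2\<close>, and for
  \<open>h = 0\<close>, where \<open>q\<^sub>1 = 0\<close>, the truncation is made at \<open>t > 0\<close> and \<open>t\<close> tends to \<open>0\<close>.

  Equality requires \<open>(p \<xi>')' = B\<close> on \<open>{q\<^sub>0..1}\<close>, which for \<open>p\<close> as stated is a direct computation
  (\<open>alg_functional_eq\<close>). It remains to see that \<open>p\<close> is admissible. The derivative of
  \<open>(q * A - h\<^sup>2) / \<xi>' q\<close> has numerator \<open>A * \<xi>' q - (q * A - h\<^sup>2) * \<xi>'' q\<close>, which decreases for \<open>q \<ge> q\<^sub>0\<close> because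
  the third derivative of \<open>\<xi>\<close> is nonnegative (\<open>numerator_antimono\<close>). In the first regime it equals
  \<open>\<xi>' 1 * (A - \<xi>'' 1) \<ge> 0\<close> at \<open>1\<close>. In the second regime, where \<open>A = \<xi>'' q\<^sub>1\<close>, it equals \<open>0\<close> at \<open>q\<^sub>1\<close>. So
  \<open>p\<close> increases, and in the second regime it joins the constant \<open>1\<close> in a continuously differentiable
  way. Existence and uniqueness of \<open>q\<^sub>1\<close> hold since the derivative of \<open>q * \<xi>'' q - \<xi>' q\<close> is \<open>q\<close> times
  the third derivative of \<open>\<xi>\<close>, which is positive for \<open>q > 0\<close> in the second regime.
\<close>

section \<open>Increasing continuously differentiable functions\<close>

lemma mono_on_deriv_nonneg:
  fixes p :: "real \<Rightarrow> real"
  assumes "mono_on {a..b} p" "a < b" "x \<in> {a..b}"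
    and "(p has_real_derivative D) (at x within {a..b})"
  shows "D \<ge> 0"
proof (rule tendsto_lowerbound)
  show "((\<lambda>y. (p y - p x) / (y - x)) \<longlongrightarrow> D) (at x within {a..b})"
    using assms(4) by (simp add: has_field_derivative_iff)
  show "\<forall>\<^sub>F y in at x within {a..b}. 0 \<le> (p y - p x) / (y - x)"
    unfolding eventually_at_filter
  proof (intro always_eventually allI impI)
    fix y assume y: "y \<noteq> x" "y \<in> {a..b}"
    show "0 \<le> (p y - p x) / (y - x)"
    proof (cases "x \<le> y")
      case True
      then have "p x \<le> p y" using assms(1,3) y by (auto simp: mono_on_def)
      then show ?thesis using True by simp
    next
      case False
      then have "p y \<le> p x" using assms(1,3) y by (auto simp: mono_on_def)
      then show ?thesis using False by (intro divide_nonpos_nonpos) auto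
    qed
  qed
  show "at x within {a..b} \<noteq> bot"
    using assms(2,3) by (simp add: trivial_limit_within islimpt_Icc)
qed

lemma mem_incr_C1I:
  assumes "a \<le> b"
    and D: "\<And>q. q \<in> {a..b} \<Longrightarrow> (p has_real_derivative p' q) (at q within {a..b})"
    and cont: "continuous_on {a..b} p'"
    and nonneg: "\<And>q. q \<in> {a..b} \<Longrightarrow> p' q \<ge> 0"
    and ends: "p a \<ge> 0" "p b \<le> 1"
  shows "p \<in> incr_C1 a b"
proof -
  have contp: "continuous_on {a..b} p"
    using D by (rule DERIV_continuous_on)
  have mono: "p x \<le> p y" if "a \<le> x" "x \<le> y" "y \<le> b" for x y
  proof (rule DERIV_nonneg_imp_increasing_open[OF that(2)])
    show "continuous_on {x..y} p" using contp that by (auto intro: continuous_on_subset)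
    fix z assume z: "x < z" "z < y"
    then have "(p has_real_derivative p' z) (at z)"
      using D[of z] that at_within_Icc_at[of a z b] by auto
    then show "\<exists>D. (p has_real_derivative D) (at z) \<and> 0 \<le> D"
      using nonneg[of z] z that by auto
  qed
  have "p x \<in> {0..1}" if "x \<in> {a..b}" for x
    using mono[of a x] mono[of x b] that ends by auto
  then show ?thesis unfolding incr_C1_def
    using mono D cont by (auto intro!: mono_onI exI[of _ p'])
qed

lemma incr_C1_cong:
  assumes "\<And>q. q \<in> {a..b} \<Longrightarrow> p q = r q"
  shows "p \<in> incr_C1 a b \<longleftrightarrow> r \<in> incr_C1 a b"
proof -
  have *: "r \<in> incr_C1 a b" if p: "p \<in> incr_C1 a b" and eq: "\<And>q. q \<in> {a..b} \<Longrightarrow> p q = r q" for p r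
  proof -
    obtain p' where "continuous_on {a..b} p'"
      and D: "\<And>q. q \<in> {a..b} \<Longrightarrow> (p has_real_derivative p' q) (at q within {a..b})"
      using p unfolding incr_C1_def by blast
    moreover have "(r has_real_derivative p' q) (at q within {a..b})" if "q \<in> {a..b}" for q
      by (rule has_field_derivative_transform_within[OF D[OF that] zero_less_one that])
        (simp add: eq)
    moreover have "mono_on {a..b} r" "r ` {a..b} \<subseteq> {0..1}"
      using p eq unfolding incr_C1_def mono_on_def by auto
    ultimately show ?thesis unfolding incr_C1_def by blast
  qed
  show ?thesis using *[of p r] *[of r p] assms by auto
qed

section \<open>From a bound and its attainment to the supremum\<close>

lemma ALG_eq_maxI:
  assumes ub: "\<And>q p. \<lbrakk>q \<in> {0..1}; p \<in> incr_C1 q 1\<rbrakk> \<Longrightarrow> alg_functional h \<xi> q p \<le> V"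
    and adm: "q0 \<in> {0..1}" "p0 \<in> incr_C1 q0 1"
    and val: "alg_functional h \<xi> q0 p0 = V"
  shows "ALG h \<xi> = ereal V \<and> ALG_maximized_at h \<xi> q0 p0"
proof
  show "ALG h \<xi> = ereal V"
  proof (rule antisym)
    show "ALG h \<xi> \<le> ereal V"
      unfolding ALG_def using ub by (intro SUP_least) auto
    show "ereal V \<le> ALG h \<xi>"
      unfolding ALG_def using adm val by (intro SUP_upper2[of q0] SUP_upper2[of p0]) auto
  qed
  show "ALG_maximized_at h \<xi> q0 p0"
    unfolding ALG_maximized_at_def is_arg_max_def using ub adm val by (auto simp: not_less)
qed

section \<open>Integration by parts against a monotone weight\<close>

text \<open>
  Formally \<open>\<integral> w u' = [w u] - \<integral> w' u\<close>, where \<open>w b * u b\<close> and \<open>- \<integral> w' u\<close> are nonnegative. The second mean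
  value theorem gives this without any regularity of the monotone \<open>w\<close>.
\<close>

lemma weighted_integral_of_derivative_ge:
  fixes u w :: "real \<Rightarrow> real"
  assumes "a \<le> b"
    and D: "\<And>x. x \<in> {a..b} \<Longrightarrow> (u has_real_derivative u' x) (at x within {a..b})"
    and u: "\<And>x. x \<in> {a..b} \<Longrightarrow> u x \<ge> 0"
    and w: "\<And>x. x \<in> {a..b} \<Longrightarrow> w x \<ge> 0"
    and anti: "\<And>x y. \<lbrakk>a \<le> x; x \<le> y; y \<le> b\<rbrakk> \<Longrightarrow> w y \<le> w x"
  shows "- (w a * u a) \<le> integral {a..b} (\<lambda>x. w x * u' x)"
proof -
  have ftc: "(u' has_integral (u d - u c)) {c..d}" if "a \<le> c" "c \<le> d" "d \<le> b" for c d
  proof (rule fundamental_theorem_of_calculus[OF that(2)])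
    fix x assume x: "x \<in> {c..d}"
    then have "(u has_real_derivative u' x) (at x within {c..d})"
      using D[of x] that by (auto intro: has_field_derivative_subset)
    then show "(u has_vector_derivative u' x) (at x within {c..d})"
      by (simp add: has_real_derivative_iff_has_vector_derivative)
  qed
  have int: "u' integrable_on {a..b}"
    using ftc[of a b] \<open>a \<le> b\<close> by (auto intro: has_integral_integrable)
  obtain c where c: "c \<in> {a..b}" and eq: "integral {a..b} (\<lambda>x. - w x * u' x)
      = - w a * integral {a..c} u' + - w b * integral {c..b} u'"
    by (rule second_mean_value_theorem[OF int \<open>a \<le> b\<close>, where g = "\<lambda>x. - w x"])
      (auto intro: anti)
  have "integral {a..b} (\<lambda>x. w x * u' x) = w a * (u c - u a) + w b * (u b - u c)"
    using eq c integral_unique[OF ftc[of a c]] integral_unique[OF ftc[of c b]] by simp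
  also have "\<dots> = (w a - w b) * u c + w b * u b - w a * u a"
    by (simp add: algebra_simps)
  also have "\<dots> \<ge> 0 + 0 - w a * u a"
    using anti[of a b] w[of b] u[of b] u[of c] c \<open>a \<le> b\<close>
    by (intro diff_right_mono add_mono mult_nonneg_nonneg) auto
  finally show ?thesis by simp
qed

section \<open>Derivatives of a mixture\<close>

text \<open>
  The properties of a mixture used for the variational problem. The interval from \<open>0\<close> to \<open>2\<close> contains
  points to the right of \<open>1\<close>, so that the two-sided derivatives at \<open>1\<close> and the limits from the right
  in \<open>ext_quotient\<close> are covered. The third derivative either is positive to the right of \<open>0\<close>, or it
  vanishes because the mixture is a multiple of \<open>x\<^sup>2\<close>.
\<close>

locale mixture_derivatives =
  fixes \<xi> :: "real \<Rightarrow> real"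
  assumes D1: "\<lbrakk>0 \<le> q; q < 2\<rbrakk> \<Longrightarrow>
      (deriv \<xi> has_real_derivative deriv (deriv \<xi>) q) (at q)"
    and D2: "\<lbrakk>0 \<le> q; q < 2\<rbrakk> \<Longrightarrow>
      (deriv (deriv \<xi>) has_real_derivative deriv (deriv (deriv \<xi>)) q) (at q)"
    and d1_0: "deriv \<xi> 0 = 0"
    and d2_0: "deriv (deriv \<xi>) 0 \<ge> 0"
    and d3_cases: "(\<forall>q\<in>{0<..<2}. deriv (deriv (deriv \<xi>)) q > 0) \<or>
      (\<forall>q\<in>{0<..<2}. deriv (deriv (deriv \<xi>)) q = 0)"
begin

abbreviation "d1 \<equiv> deriv \<xi>"
abbreviation "d2 \<equiv> deriv (deriv \<xi>)"
abbreviation "d3 \<equiv> deriv (deriv (deriv \<xi>))"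

lemma d3_nonneg: "0 < q \<Longrightarrow> q < 2 \<Longrightarrow> 0 \<le> d3 q"
  using d3_cases by (metis greaterThanLessThan_iff less_eq_real_def)

lemma cont_d1: "continuous_on {0..<2} d1"
  by (intro continuous_at_imp_continuous_on ballI DERIV_isCont[OF D1]) auto

lemma cont_d2: "continuous_on {0..<2} d2"
  by (intro continuous_at_imp_continuous_on ballI DERIV_isCont[OF D2]) auto

lemma cont_Icc:
  assumes "0 \<le> a" "b < 2"
  shows "continuous_on {a..b} d1" "continuous_on {a..b} d2"
  using assms by (auto intro: continuous_on_subset[OF cont_d1] continuous_on_subset[OF cont_d2])

lemma d2_mono: "d2 x \<le> d2 y" if "0 \<le> x" "x \<le> y" "y < 2"
proof (rule DERIV_nonneg_imp_increasing_open[OF that(2)])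
  show "continuous_on {x..y} d2" using that by (intro cont_Icc) auto
  fix z assume "x < z" "z < y"
  then show "\<exists>D. (d2 has_real_derivative D) (at z) \<and> 0 \<le> D"
    using D2[of z] d3_nonneg[of z] that by auto
qed

lemma d2_nonneg: "0 \<le> x \<Longrightarrow> x < 2 \<Longrightarrow> 0 \<le> d2 x"
  using d2_mono[of 0 x] d2_0 by auto

lemma d1_mono: "d1 x \<le> d1 y" if "0 \<le> x" "x \<le> y" "y < 2"
proof (rule DERIV_nonneg_imp_increasing_open[OF that(2)])
  show "continuous_on {x..y} d1" using that by (intro cont_Icc) auto
  fix z assume "x < z" "z < y"
  then show "\<exists>D. (d1 has_real_derivative D) (at z) \<and> 0 \<le> D"
    using D1[of z] d2_nonneg[of z] that by auto
qed

lemma d1_nonneg: "0 \<le> x \<Longrightarrow> x < 2 \<Longrightarrow> 0 \<le> d1 x"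
  using d1_mono[of 0 x] d1_0 by auto

lemma d2_const:
  assumes "\<forall>q\<in>{0<..<2}. d3 q = 0" "0 \<le> x" "x < 2"
  shows "d2 x = d2 0"
proof (cases "x = 0")
  case False
  show ?thesis
  proof (rule DERIV_isconst2[of 0 x])
    fix y assume "0 < y" "y < x"
    then show "(d2 has_real_derivative 0) (at y)"
      using D2[of y] assms by auto
  qed (use False assms in \<open>auto intro: cont_Icc\<close>)
qed auto

lemma d1_linear:
  assumes "\<forall>q\<in>{0<..<2}. d3 q = 0" "0 \<le> x" "x < 2"
  shows "d1 x = d2 0 * x"
proof (cases "x = 0")
  case False
  have "(\<lambda>x. d1 x - d2 0 * x) x = (\<lambda>x. d1 x - d2 0 * x) 0"
  proof (rule DERIV_isconst2[of 0 x])
    show "continuous_on {0..x} (\<lambda>x. d1 x - d2 0 * x)"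
      using assms by (intro continuous_intros cont_Icc) auto
    fix y assume "0 < y" "y < x"
    then show "((\<lambda>x. d1 x - d2 0 * x) has_real_derivative 0) (at y)"
      using assms d2_const[of y] D1[of y] by (auto intro!: derivative_eq_intros)
  qed (use False assms in auto)
  then show ?thesis using d1_0 by simp
qed (use d1_0 in auto)

text \<open>The second alternative is that of the zero mixture, where the quotients defining \<open>p\<close> are \<open>0 / 0\<close>.\<close>

lemma degenerate_or_positive:
  "(\<forall>q\<in>{0<..<2}. 0 < d1 q \<and> 0 < d2 q) \<or> (\<forall>q\<in>{0..<2}. d1 q = 0 \<and> d2 q = 0)"
proof (cases "\<exists>q\<in>{0<..<2}. d2 q = 0")
  case True
  then obtain q where q: "0 < q" "q < 2" "d2 q = 0" by auto
  have "\<not> d3 (q/2) > 0"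
  proof
    assume "d3 (q/2) > 0"
    then have "\<forall>x\<in>{0<..<2}. d3 x > 0" using d3_cases q by force
    have "d2 0 < d2 q"
    proof (rule DERIV_pos_imp_increasing_open[of 0 q])
      fix y assume "0 < y" "y < q"
      then show "\<exists>D. (d2 has_real_derivative D) (at y) \<and> 0 < D"
        using D2[of y] q \<open>\<forall>x\<in>{0<..<2}. d3 x > 0\<close> by auto
    qed (use q in \<open>auto intro: cont_Icc\<close>)
    then show False using d2_0 q by simp
  qed
  then have z: "\<forall>x\<in>{0<..<2}. d3 x = 0" using d3_cases q by force
  have "d2 0 = 0" using d2_const[OF z, of q] q by simp
  then have "d1 q = 0 \<and> d2 q = 0" if "q \<in> {0..<2}" for q
    using that d2_const[OF z, of q] d1_linear[OF z, of q] by simp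
  then show ?thesis by blast
next
  case False
  then have pos: "0 < d2 q" if "0 < q" "q < 2" for q
    using that d2_nonneg[of q] by force
  have "0 < d1 q" if "0 < q" "q < 2" for q
  proof -
    have "d1 0 < d1 q"
    proof (rule DERIV_pos_imp_increasing_open[of 0 q])
      fix y assume "0 < y" "y < q"
      then show "\<exists>D. (d1 has_real_derivative D) (at y) \<and> 0 < D"
        using D1[of y] pos[of y] that by auto
    qed (use that in \<open>auto intro: cont_Icc\<close>)
    then show ?thesis by (simp add: d1_0)
  qed
  with pos show ?thesis by auto
qed

lemma integral_d2:
  assumes "0 \<le> a" "a \<le> b" "b < 2"
  shows "(d2 has_integral d1 b - d1 a) {a..b}"
  using assms D1 by (intro fundamental_theorem_of_calculus)
    (auto simp flip: has_real_derivative_iff_has_vector_derivative intro: has_field_derivative_at_within)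

section \<open>Weak duality\<close>

text \<open>The weak duality bound, with weight \<open>w = 1 / sqrt B\<close>.\<close>

lemma alg_functional_le:
  assumes q0: "q0 \<in> {0..1}" and p: "p \<in> incr_C1 q0 1"
    and contB: "continuous_on {0..1} B"
    and monoB: "\<And>x y. \<lbrakk>0 \<le> x; x \<le> y; y \<le> 1\<rbrakk> \<Longrightarrow> B x \<le> B y"
    and B0: "B 0 > 0"
  shows "alg_functional h \<xi> q0 p \<le>
    (h\<^sup>2 / sqrt (B 0) + integral {0..1} (\<lambda>q. sqrt (B q) + d2 q / sqrt (B q))) / 2"
proof -
  define w where "w = (\<lambda>q. 1 / sqrt (B q))"
  have Bpos: "B q > 0" if "q \<in> {0..1}" for q
    using monoB[of 0 q] B0 that by auto
  have wpos: "w q > 0" if "q \<in> {0..1}" for q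
    using Bpos[OF that] by (simp add: w_def)
  have w_anti: "w y \<le> w x" if "0 \<le> x" "x \<le> y" "y \<le> 1" for x y
    using monoB[OF that] Bpos[of x] Bpos[of y] that by (simp add: w_def frac_le)
  have contw: "continuous_on {0..1} w"
    unfolding w_def by (intro continuous_intros contB) (use Bpos in force)
  obtain p' where contp': "continuous_on {q0..1} p'"
    and Dp: "\<And>q. q \<in> {q0..1} \<Longrightarrow> (p has_real_derivative p' q) (at q within {q0..1})"
    and p01: "\<And>q. q \<in> {q0..1} \<Longrightarrow> p q \<in> {0..1}" and monop: "mono_on {q0..1} p"
    using p unfolding incr_C1_def by blast
  have contp: "continuous_on {q0..1} p"
    using Dp by (rule DERIV_continuous_on)
  have D1w: "(d1 has_real_derivative d2 q) (at q within {q0..1})" if "q \<in> {q0..1}" for q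
    using D1[of q] that q0 by (auto intro: has_field_derivative_at_within)
  define D where "D = (\<lambda>q. p' q * d1 q + p q * d2 q)"
  have contD: "continuous_on {q0..1} D"
    unfolding D_def using q0 by (intro continuous_intros contp' contp cont_Icc) auto
  have sub: "{q0..1} \<subseteq> {0..1}" "{0..q0} \<subseteq> {0..1}" using q0 by auto
  note contw1 = continuous_on_subset[OF contw sub(1)] continuous_on_subset[OF contw sub(2)]
  note contB1 = continuous_on_subset[OF contB sub(1)] continuous_on_subset[OF contB sub(2)]
  have cd2: "continuous_on {q0..1} d2" "continuous_on {0..q0} d2" "continuous_on {0..1} d2"
    using q0 by (auto intro: cont_Icc)
  \<comment> \<open>For \<open>q0 = 1\<close> both integrals are over a point; otherwise the derivative within the interval is
    unique, and it is nonnegative, so that the square root is the genuine one.\<close>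
  have int1: "integral {q0..1} (\<lambda>q. sqrt (vector_derivative (\<lambda>s. p s * d1 s) (at q within {q0..1})))
      \<le> integral {q0..1} (\<lambda>q. (w q * D q + sqrt (B q)) / 2)"
  proof (cases "q0 = 1")
    case False
    then have q01: "q0 < 1" using q0 by auto
    have "integral {q0..1} (\<lambda>q. sqrt (vector_derivative (\<lambda>s. p s * d1 s) (at q within {q0..1})))
      = integral {q0..1} (\<lambda>q. sqrt (D q))"
    proof (rule integral_cong)
      fix q assume q: "q \<in> {q0..1}"
      have "((\<lambda>s. p s * d1 s) has_real_derivative D q) (at q within {q0..1})"
        unfolding D_def using Dp[OF q] D1w[OF q]
        by (auto intro!: derivative_eq_intros)
      then show "sqrt (vector_derivative (\<lambda>s. p s * d1 s) (at q within {q0..1})) = sqrt (D q)"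
        using vector_derivative_within_closed_interval[OF q01 q]
        by (simp add: has_real_derivative_iff_has_vector_derivative)
    qed
    also have "\<dots> \<le> integral {q0..1} (\<lambda>q. (w q * D q + sqrt (B q)) / 2)"
    proof (rule integral_le)
      show "(\<lambda>q. sqrt (D q)) integrable_on {q0..1}"
        by (intro integrable_continuous_real continuous_intros contD)
      show "(\<lambda>q. (w q * D q + sqrt (B q)) / 2) integrable_on {q0..1}"
        by (intro integrable_continuous_real continuous_intros contD contw1 contB1) auto
      fix q assume q: "q \<in> {q0..1}"
      have D0: "D q \<ge> 0" unfolding D_def
        using mono_on_deriv_nonneg[OF monop q01 q Dp[OF q]] p01[OF q] d1_nonneg[of q] d2_nonneg[of q] q q0
        by auto
      have "sqrt (D q) = sqrt (w q * D q * sqrt (B q))"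
        using Bpos[of q] q q0 by (simp add: w_def)
      also have "\<dots> \<le> (w q * D q + sqrt (B q)) / 2"
        using D0 wpos[of q] Bpos[of q] q q0 by (intro arith_geo_mean_sqrt) auto
      finally show "sqrt (D q) \<le> (w q * D q + sqrt (B q)) / 2" .
    qed
    finally show ?thesis .
  qed auto
  \<comment> \<open>Replacing \<open>p\<close> by \<open>1\<close>: integration by parts for \<open>(1 - p) * d1\<close>, whose derivative is \<open>d2 - D\<close>.
    The boundary term at \<open>q0\<close> is then absorbed by extending the integral of \<open>w * d2\<close> down to \<open>0\<close>.\<close>
  have "- (w q0 * ((1 - p q0) * d1 q0)) \<le> integral {q0..1} (\<lambda>q. w q * (d2 q - D q))"
  proof (rule weighted_integral_of_derivative_ge)
    fix q assume q: "q \<in> {q0..1}"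
    show "((\<lambda>q. (1 - p q) * d1 q) has_real_derivative d2 q - D q) (at q within {q0..1})"
      using Dp[OF q] D1w[OF q] by (auto intro!: derivative_eq_intros simp: D_def algebra_simps)
    show "0 \<le> (1 - p q) * d1 q" using p01[OF q] d1_nonneg[of q] q q0 by auto
    show "0 \<le> w q" using wpos[of q] q q0 by auto
  qed (use q0 w_anti in auto)
  also have "\<dots> = integral {q0..1} (\<lambda>q. w q * d2 q) - integral {q0..1} (\<lambda>q. w q * D q)"
    unfolding right_diff_distrib
    by (intro integral_diff integrable_continuous_real continuous_intros contD contw1 cd2)
  finally have "integral {q0..1} (\<lambda>q. w q * D q)
      \<le> integral {q0..1} (\<lambda>q. w q * d2 q) + w q0 * ((1 - p q0) * d1 q0)" by simp
  also have "w q0 * ((1 - p q0) * d1 q0) \<le> w q0 * d1 q0"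
    using p01[of q0] q0 wpos[of q0] d1_nonneg[of q0] by (intro mult_left_mono mult_left_le_one_le) auto
  also have "w q0 * d1 q0 = integral {0..q0} (\<lambda>q. w q0 * d2 q)"
    using integral_unique[OF integral_d2[of 0 q0]] q0 d1_0 by simp
  also have "\<dots> \<le> integral {0..q0} (\<lambda>q. w q * d2 q)"
    using q0 w_anti d2_nonneg
    by (intro integral_le integrable_continuous_real continuous_intros contw1 cd2 mult_right_mono) auto
  also have "integral {q0..1} (\<lambda>q. w q * d2 q) + integral {0..q0} (\<lambda>q. w q * d2 q)
      = integral {0..1} (\<lambda>q. w q * d2 q)"
    using q0 Henstock_Kurzweil_Integration.integral_combine[of 0 q0 1 "\<lambda>q. w q * d2 q"]
    by (simp add: integrable_continuous_real continuous_on_mult contw cd2 add.commute)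
  finally have wD: "integral {q0..1} (\<lambda>q. w q * D q) \<le> integral {0..1} (\<lambda>q. w q * d2 q)"
    by simp
  have "q0 * sqrt (B 0) = integral {0..q0} (\<lambda>q. sqrt (B 0))"
    using q0 by simp
  also have "\<dots> \<le> integral {0..q0} (\<lambda>q. sqrt (B q))"
    using q0 monoB by (intro integral_le integrable_continuous_real continuous_intros contB1) auto
  also have "\<dots> = integral {0..1} (\<lambda>q. sqrt (B q)) - integral {q0..1} (\<lambda>q. sqrt (B q))"
    using q0 Henstock_Kurzweil_Integration.integral_combine[of 0 q0 1 "\<lambda>q. sqrt (B q)"]
    by (simp add: integrable_continuous_real continuous_on_real_sqrt contB)
  finally have s: "q0 * sqrt (B 0) + integral {q0..1} (\<lambda>q. sqrt (B q)) \<le> integral {0..1} (\<lambda>q. sqrt (B q))"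
    by simp
  have "h * sqrt q0 \<le> sqrt (h\<^sup>2 / sqrt (B 0) * (q0 * sqrt (B 0)))"
    using B0 q0 by (simp add: real_sqrt_mult mult_right_mono)
  also have "\<dots> \<le> (h\<^sup>2 / sqrt (B 0) + q0 * sqrt (B 0)) / 2"
    using B0 q0 by (intro arith_geo_mean_sqrt) auto
  finally have hq: "h * sqrt q0 \<le> (h\<^sup>2 / sqrt (B 0) + q0 * sqrt (B 0)) / 2" .
  have e1: "integral {q0..1} (\<lambda>q. (w q * D q + sqrt (B q)) / 2)
     = (integral {q0..1} (\<lambda>q. w q * D q) + integral {q0..1} (\<lambda>q. sqrt (B q))) / 2"
    by (simp add: integral_add integrable_continuous_real continuous_on_mult continuous_on_real_sqrt contw1 contD contB1)
  have e2: "integral {0..1} (\<lambda>q. sqrt (B q) + d2 q / sqrt (B q))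
     = integral {0..1} (\<lambda>q. sqrt (B q)) + integral {0..1} (\<lambda>q. w q * d2 q)"
  proof -
    have "sqrt (B q) + d2 q / sqrt (B q) = sqrt (B q) + w q * d2 q" for q
      by (simp add: w_def)
    then show ?thesis
      by (simp add: integral_add integrable_continuous_real continuous_on_mult
          continuous_on_real_sqrt contw cd2 contB)
  qed
  show ?thesis
    unfolding alg_functional_def using int1 wD s hq e1 e2 by argo
qed

text \<open>
  The constant weight. It is perturbed by \<open>e\<^sup>2\<close> because \<open>d1 1 + h\<^sup>2\<close> is zero when the mixture and \<open>h\<close>
  both vanish.
\<close>

lemma alg_functional_le_sqrt:
  assumes "q0 \<in> {0..1}" "p \<in> incr_C1 q0 1"
  shows "alg_functional h \<xi> q0 p \<le> sqrt (d1 1 + h\<^sup>2)"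
proof (rule field_le_epsilon)
  fix e :: real assume e: "0 < e"
  define A where "A = d1 1 + h\<^sup>2"
  define B where "B = A + e\<^sup>2"
  have A0: "A \<ge> 0" using d1_nonneg[of 1] by (simp add: A_def)
  have B: "B > 0" using A0 e by (simp add: B_def add_nonneg_pos)
  have "((\<lambda>q. sqrt B + d2 q / sqrt B) has_integral (1 - 0) * sqrt B + (d1 1 - d1 0) / sqrt B) {0..1}"
    using has_integral_const_real[of "sqrt B" 0 1]
    by (intro has_integral_add has_integral_divide integral_d2) auto
  then have "alg_functional h \<xi> q0 p \<le> (h\<^sup>2 / sqrt B + (sqrt B + d1 1 / sqrt B)) / 2"
    using alg_functional_le[OF assms, of "\<lambda>_. B" h] B d1_0 by (simp add: integral_unique)
  also have "\<dots> = (A / sqrt B + sqrt B) / 2"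
    by (simp add: A_def add_divide_distrib)
  also have "A / sqrt B \<le> B / sqrt B"
    using B by (intro divide_right_mono) (auto simp: B_def)
  also have "B / sqrt B = sqrt B" by (rule real_div_sqrt) (use B in simp)
  also have "(sqrt B + sqrt B) / 2 = sqrt B" by simp
  also have "sqrt B \<le> sqrt A + sqrt (e\<^sup>2)"
    unfolding B_def using A0 by (intro sqrt_add_le_add_sqrt) auto
  finally show "alg_functional h \<xi> q0 p \<le> sqrt (d1 1 + h\<^sup>2) + e"
    using e by (simp add: A_def)
qed

text \<open>
  The weight \<open>1 / sqrt (d2 (max q t))\<close>. The bound is stated for every \<open>t\<close> with \<open>d2 t > 0\<close>, since
  \<open>d2 0\<close> may vanish.
\<close>

lemma alg_functional_le_truncated:
  assumes "q0 \<in> {0..1}" "p \<in> incr_C1 q0 1" and t: "0 \<le> t" "t \<le> 1" and pos: "0 < d2 t"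
  shows "alg_functional h \<xi> q0 p \<le> ((h\<^sup>2 + d1 t) / sqrt (d2 t) + t * sqrt (d2 t)) / 2
    + integral {t..1} (\<lambda>q. sqrt (d2 q))"
proof -
  define B where "B = (\<lambda>q. d2 (max q t))"
  have contB: "continuous_on {0..1} B"
    unfolding B_def using t
    by (intro continuous_on_compose2[OF cont_d2] continuous_intros) auto
  have monoB: "B x \<le> B y" if "0 \<le> x" "x \<le> y" "y \<le> 1" for x y
    unfolding B_def using that t by (intro d2_mono) auto
  have B0: "B 0 = d2 t" using t by (simp add: B_def max_def)
  have i1: "((\<lambda>q. sqrt (B q) + d2 q / sqrt (B q)) has_integral
      (t - 0) * sqrt (d2 t) + (d1 t - d1 0) / sqrt (d2 t)) {0..t}"
  proof (rule has_integral_eq[where f = "\<lambda>q. sqrt (d2 t) + d2 q / sqrt (d2 t)"])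
    show "((\<lambda>q. sqrt (d2 t) + d2 q / sqrt (d2 t)) has_integral
      (t - 0) * sqrt (d2 t) + (d1 t - d1 0) / sqrt (d2 t)) {0..t}"
      using has_integral_const_real[of "sqrt (d2 t)" 0 t] t
      by (intro has_integral_add has_integral_divide integral_d2) auto
  qed (auto simp: B_def max_def)
  have i2: "((\<lambda>q. sqrt (B q) + d2 q / sqrt (B q)) has_integral
      2 * integral {t..1} (\<lambda>q. sqrt (d2 q))) {t..1}"
  proof (rule has_integral_eq[where f = "\<lambda>q. 2 * sqrt (d2 q)"])
    show "((\<lambda>q. 2 * sqrt (d2 q)) has_integral 2 * integral {t..1} (\<lambda>q. sqrt (d2 q))) {t..1}"
      using t by (intro has_integral_mult_right integrable_integral integrable_continuous_real
          continuous_intros cont_Icc) auto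
    fix q assume "q \<in> {t..1}"
    then show "2 * sqrt (d2 q) = sqrt (B q) + d2 q / sqrt (B q)"
      using d2_nonneg[of q] t by (auto simp: B_def max_def real_div_sqrt)
  qed
  have "integral {0..1} (\<lambda>q. sqrt (B q) + d2 q / sqrt (B q))
     = t * sqrt (d2 t) + d1 t / sqrt (d2 t) + 2 * integral {t..1} (\<lambda>q. sqrt (d2 q))"
    using integral_unique[OF has_integral_combine[OF t i1 i2]] d1_0 by simp
  with alg_functional_le[OF assms(1,2) contB monoB, of h] B0 pos
  show ?thesis by (simp add: add_divide_distrib)
qed

section \<open>Value and admissibility of the candidate paths\<close>

text \<open>The value at a path for which the derivative of \<open>p * d1\<close> is \<open>A\<close> on \<open>{a..M}\<close> and \<open>d2\<close> on \<open>{M..1}\<close>.\<close>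

lemma alg_functional_eq:
  assumes a: "a \<in> {0..1}" and M: "M \<in> {a..1}"
    and D: "\<And>q. \<lbrakk>a < 1; q \<in> {a..1}\<rbrakk> \<Longrightarrow>
      ((\<lambda>s. p s * d1 s) has_real_derivative (if q \<le> M then A else d2 q)) (at q within {a..1})"
    and A: "M < 1 \<Longrightarrow> A = d2 M"
  shows "alg_functional h \<xi> a p = h * sqrt a + (M - a) * sqrt A + integral {M..1} (\<lambda>q. sqrt (d2 q))"
proof (cases "a < 1")
  case True
  define g where "g = (\<lambda>q. sqrt (if q \<le> M then A else d2 q))"
  have i1: "(g has_integral (M - a) * sqrt A) {a..M}"
    by (rule has_integral_eq[where f = "\<lambda>_. sqrt A"])
      (use M has_integral_const_real[of "sqrt A" a M] in \<open>auto simp: g_def\<close>)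
  have i2: "(g has_integral integral {M..1} (\<lambda>q. sqrt (d2 q))) {M..1}"
  proof (cases "M < 1")
    case True
    show ?thesis
    proof (rule has_integral_eq[where f = "\<lambda>q. sqrt (d2 q)"])
      show "((\<lambda>q. sqrt (d2 q)) has_integral integral {M..1} (\<lambda>q. sqrt (d2 q))) {M..1}"
        using a M by (intro integrable_integral integrable_continuous_real continuous_intros cont_Icc) auto
      show "sqrt (d2 q) = g q" if "q \<in> {M..1}" for q
        using that A[OF True] by (cases "q = M") (auto simp: g_def)
    qed
  next
    case False
    then have "M = 1" using M by auto
    then show ?thesis using has_integral_refl(2)[of g 1] by simp
  qed
  have "(g has_integral (M - a) * sqrt A + integral {M..1} (\<lambda>q. sqrt (d2 q))) {a..1}"
    using has_integral_combine[OF _ _ i1 i2] M by auto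
  moreover have "integral {a..1} (\<lambda>q. sqrt (vector_derivative (\<lambda>s. p s * d1 s) (at q within {a..1})))
      = integral {a..1} g"
  proof (rule integral_cong)
    fix q assume q: "q \<in> {a..1}"
    show "sqrt (vector_derivative (\<lambda>s. p s * d1 s) (at q within {a..1})) = g q"
      using vector_derivative_within_closed_interval[OF True q] D[OF True q]
      unfolding g_def has_real_derivative_iff_has_vector_derivative by metis
  qed
  ultimately show ?thesis
    unfolding alg_functional_def by (simp add: integral_unique)
next
  case False
  then have "a = 1" "M = 1" using a M by auto
  then show ?thesis by (simp add: alg_functional_def)
qed

lemma linear_path_derivative:
  assumes "0 < q" "q < 2" "d1 q \<noteq> 0"
  shows "((\<lambda>s. (s * A - c) / d1 s) has_real_derivative
     (A * d1 q - (q * A - c) * d2 q) / (d1 q)\<^sup>2) (at q)"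
  using assms D1[of q] by (auto intro!: derivative_eq_intros simp: power2_eq_square)

lemma numerator_antimono:
  assumes "0 < x" "x \<le> y" "y < 2" "c \<le> x * A" "0 \<le> A"
  shows "A * d1 y - (y * A - c) * d2 y \<le> A * d1 x - (x * A - c) * d2 x"
proof (rule DERIV_nonpos_imp_decreasing_open[OF \<open>x \<le> y\<close>])
  show "continuous_on {x..y} (\<lambda>q. A * d1 q - (q * A - c) * d2 q)"
    using assms by (intro continuous_intros cont_Icc) auto
  fix z assume z: "x < z" "z < y"
  have "((\<lambda>q. A * d1 q - (q * A - c) * d2 q) has_real_derivative - ((z * A - c) * d3 z)) (at z)"
    using z assms D1[of z] D2[of z] by (auto intro!: derivative_eq_intros simp: algebra_simps)
  moreover have "c \<le> z * A" using z assms mult_right_mono[of x z A] by linarith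
  then have "(z * A - c) * d3 z \<ge> 0" using d3_nonneg[of z] z assms by auto
  ultimately show "\<exists>D. ((\<lambda>q. A * d1 q - (q * A - c) * d2 q) has_real_derivative D) (at z) \<and> D \<le> 0"
    by (intro exI[of _ "- ((z * A - c) * d3 z)"]) auto
qed

section \<open>The threshold\<close>

lemma d3_pos:
  assumes "d1 1 < d2 1"
  shows "\<forall>q\<in>{0<..<2}. d3 q > 0"
proof (rule ccontr)
  assume "\<not> ?thesis"
  then have z: "\<forall>q\<in>{0<..<2}. d3 q = 0" using d3_cases by blast
  show False using d2_const[OF z, of 1] d1_linear[OF z, of 1] assms by simp
qed

lemma threshold_increasing:
  assumes d3: "\<forall>q\<in>{0<..<2}. d3 q > 0" and xy: "0 \<le> x" "x < y" "y < 2"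
  shows "x * d2 x - d1 x < y * d2 y - d1 y"
proof -
  have "(\<lambda>q. q * d2 q - d1 q) x < (\<lambda>q. q * d2 q - d1 q) y"
  proof (rule DERIV_pos_imp_increasing_open[OF \<open>x < y\<close>])
    show "continuous_on {x..y} (\<lambda>q. q * d2 q - d1 q)"
      using xy by (intro continuous_intros cont_Icc) auto
    fix z assume z: "x < z" "z < y"
    have "((\<lambda>q. q * d2 q - d1 q) has_real_derivative z * d3 z) (at z)"
      using z xy D1[of z] D2[of z] by (auto intro!: derivative_eq_intros)
    moreover have "z * d3 z > 0" using z xy d3 by auto
    ultimately show "\<exists>D. ((\<lambda>q. q * d2 q - d1 q) has_real_derivative D) (at z) \<and> 0 < D"
      by blast
  qed
  then show "x * d2 x - d1 x < y * d2 y - d1 y" by simp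
qed

lemma ex1_threshold:
  assumes "d1 1 + h\<^sup>2 < d2 1"
  shows "\<exists>!q1. q1 \<in> {0..<1} \<and> d1 q1 + h\<^sup>2 = q1 * d2 q1"
proof -
  have less: "d1 1 < d2 1" using assms zero_le_power2[of h] by linarith
  note inc = threshold_increasing[OF d3_pos[OF less]]
  have "\<exists>x\<ge>0. x \<le> 1 \<and> x * d2 x - d1 x = h\<^sup>2"
    using d1_0 assms by (intro IVT' continuous_intros cont_Icc) auto
  then obtain q1 where q1: "0 \<le> q1" "q1 \<le> 1" "q1 * d2 q1 - d1 q1 = h\<^sup>2" by blast
  then have "q1 \<noteq> 1" using assms by auto
  then show ?thesis
  proof (intro ex1I[of _ q1])
    fix y assume y: "y \<in> {0..<1} \<and> d1 y + h\<^sup>2 = y * d2 y"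
    show "y = q1"
      using inc[of y q1] inc[of q1 y] y q1 by (cases y q1 rule: linorder_cases) auto
  qed (use q1 in auto)
qed

section \<open>The two regimes\<close>

lemma ALG_linear_regime:
  assumes h: "h \<ge> 0" and ge: "d1 1 + h\<^sup>2 \<ge> d2 1"
  shows "ALG h \<xi> = ereal (sqrt (d1 1 + h\<^sup>2)) \<and>
    ALG_maximized_at h \<xi> (h\<^sup>2 / (d1 1 + h\<^sup>2))
      (ext_quotient (\<lambda>q. q * (d1 1 + h\<^sup>2) - h\<^sup>2) d1)"
proof -
  define A where "A = d1 1 + h\<^sup>2"
  define a where "a = h\<^sup>2 / A"
  define p where "p = ext_quotient (\<lambda>q. q * A - h\<^sup>2) d1"
  have A0: "0 \<le> A" "h\<^sup>2 \<le> A" using d1_nonneg[of 1] by (auto simp: A_def)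
  have a: "a \<in> {0..1}" using A0 by (auto simp: a_def divide_le_eq_1)
  have "p \<in> incr_C1 a 1 \<and> (a < 1 \<longrightarrow> (\<forall>q\<in>{a..1}. p q * d1 q = q * A - h\<^sup>2))"
  proof (cases "\<forall>q\<in>{0..<2}. d1 q = 0 \<and> d2 q = 0")
    case True
    \<comment> \<open>The zero mixture: every quotient \<open>x / 0\<close> near \<open>q\<close> is \<open>0\<close>, and so is its limit.\<close>
    have "p q = 0" if "q \<in> {a..1}" for q
    proof -
      have "((\<lambda>s. (s * A - h\<^sup>2) / d1 s) \<longlongrightarrow> 0) (at_right q)"
      proof (rule tendsto_eventually)
        have "\<forall>\<^sub>F s in at_right q. s \<in> {q<..<2}"
          using that by (intro eventually_at_right_less eventually_at_rightI[of q 2]) auto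
        then show "\<forall>\<^sub>F s in at_right q. (s * A - h\<^sup>2) / d1 s = 0"
          by eventually_elim (use True that a in auto)
      qed
      then show ?thesis
        using True that a by (auto simp: p_def ext_quotient_def intro!: tendsto_Lim)
    qed
    then have "p \<in> incr_C1 a 1 \<longleftrightarrow> (\<lambda>_. 0) \<in> incr_C1 a 1"
      by (rule incr_C1_cong)
    moreover have "(\<lambda>_. 0) \<in> incr_C1 a 1"
      using a by (intro mem_incr_C1I[where p' = "\<lambda>_. 0"]) auto
    moreover have "A = 0" if "a < 1"
      using that True by (cases "h = 0") (auto simp: a_def A_def)
    ultimately show ?thesis using True a by (auto simp: A_def)
  next
    case False
    then have pos: "0 < d1 q" "0 < d2 q" if "0 < q" "q < 2" for q
      using degenerate_or_positive that by auto
    have Apos: "0 < A" using pos(1)[of 1] by (simp add: A_def add_pos_nonneg)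
    show ?thesis
    proof (cases "h = 0")
      case True
      \<comment> \<open>Now \<open>d1 1 \<ge> d2 1\<close>, which forces the mixture to be a multiple of \<open>x\<^sup>2\<close>; the path is constantly \<open>1\<close>.\<close>
      have z: "\<forall>q\<in>{0<..<2}. d3 q = 0"
      proof (rule ccontr)
        assume "\<not> ?thesis"
        then have "\<forall>q\<in>{0<..<2}. d3 q > 0" using d3_cases by blast
        then show False
          using threshold_increasing[of 0 1] ge True d1_0 by simp
      qed
      have lin: "d1 q = A * q" if "0 \<le> q" "q < 2" for q
        using d1_linear[OF z that] d1_linear[OF z, of 1] True by (simp add: A_def)
      have "p q = 1" if "q \<in> {a..1}" for q
      proof (cases "q = 0")
        case True
        have "((\<lambda>s. (s * A - h\<^sup>2) / d1 s) \<longlongrightarrow> 1) (at_right 0)"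
        proof (rule tendsto_eventually)
          have "\<forall>\<^sub>F s in at_right (0::real). s \<in> {0<..<2}"
            by (intro eventually_at_rightI[of 0 2]) auto
          then show "\<forall>\<^sub>F s in at_right 0. (s * A - h\<^sup>2) / d1 s = 1"
            by eventually_elim (use lin Apos \<open>h = 0\<close> in auto)
        qed
        then show ?thesis
          using True d1_0 by (auto simp: p_def ext_quotient_def intro!: tendsto_Lim)
      next
        case False
        then show ?thesis
          using that a lin[of q] Apos \<open>h = 0\<close> by (auto simp: p_def ext_quotient_def)
      qed
      then have "p \<in> incr_C1 a 1 \<longleftrightarrow> (\<lambda>_. 1) \<in> incr_C1 a 1"
        and "\<forall>q\<in>{a..1}. p q * d1 q = q * A - h\<^sup>2"
        using lin a True by (intro incr_C1_cong, auto)
      moreover have "(\<lambda>_. 1) \<in> incr_C1 a 1"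
        using a by (intro mem_incr_C1I[where p' = "\<lambda>_. 0"]) auto
      ultimately show ?thesis by simp
    next
      case False
      then have apos: "0 < a" using Apos by (simp add: a_def)
      have aA: "a * A = h\<^sup>2" using Apos by (simp add: a_def)
      have pq: "p q = (q * A - h\<^sup>2) / d1 q" if "q \<in> {a..1}" for q
        using pos(1)[of q] that apos by (auto simp: p_def ext_quotient_def)
      then have "p \<in> incr_C1 a 1 \<longleftrightarrow> (\<lambda>q. (q * A - h\<^sup>2) / d1 q) \<in> incr_C1 a 1"
        by (rule incr_C1_cong)
      moreover have "(\<lambda>q. (q * A - h\<^sup>2) / d1 q) \<in> incr_C1 a 1"
      proof (rule mem_incr_C1I[where p' = "\<lambda>q. (A * d1 q - (q * A - h\<^sup>2) * d2 q) / (d1 q)\<^sup>2"])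
        fix q assume q: "q \<in> {a..1}"
        show "((\<lambda>q. (q * A - h\<^sup>2) / d1 q) has_real_derivative
            (A * d1 q - (q * A - h\<^sup>2) * d2 q) / (d1 q)\<^sup>2) (at q within {a..1})"
          using linear_path_derivative[of q A "h\<^sup>2"] pos(1)[of q] q apos
          by (auto intro: has_field_derivative_at_within)
        have "A * d1 1 - (1 * A - h\<^sup>2) * d2 1 = d1 1 * (A - d2 1)"
          by (simp add: A_def algebra_simps)
        also have "\<dots> \<ge> 0" using ge d1_nonneg[of 1] by (simp add: A_def)
        finally have "0 \<le> A * d1 q - (q * A - h\<^sup>2) * d2 q"
          using numerator_antimono[of q 1 "h\<^sup>2" A] q apos aA A0 mult_right_mono[of a q A] by auto
        then show "0 \<le> (A * d1 q - (q * A - h\<^sup>2) * d2 q) / (d1 q)\<^sup>2" by simp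
      next
        have "d1 q \<noteq> 0" if "q \<in> {a..1}" for q using pos(1)[of q] that apos by auto
        then show "continuous_on {a..1} (\<lambda>q. (A * d1 q - (q * A - h\<^sup>2) * d2 q) / (d1 q)\<^sup>2)"
          using apos by (intro continuous_intros cont_Icc) auto
        show "(1 * A - h\<^sup>2) / d1 1 \<le> 1" using pos(1)[of 1] by (simp add: A_def)
      qed (use a aA in auto)
      moreover have "p q * d1 q = q * A - h\<^sup>2" if "q \<in> {a..1}" for q
        using pq[OF that] pos(1)[of q] that apos by simp
      ultimately show ?thesis by blast
    qed
  qed
  then have p: "p \<in> incr_C1 a 1"
    and eq: "\<And>q. \<lbrakk>a < 1; q \<in> {a..1}\<rbrakk> \<Longrightarrow> p q * d1 q = q * A - h\<^sup>2" by auto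
  have "alg_functional h \<xi> a p
      = h * sqrt a + (1 - a) * sqrt A + integral {1..1} (\<lambda>q. sqrt (d2 q))"
  proof (rule alg_functional_eq)
    fix q :: real assume a1: "a < 1" and q: "q \<in> {a..1}"
    have "((\<lambda>s. s * A - h\<^sup>2) has_real_derivative A) (at q within {a..1})"
      by (auto intro!: derivative_eq_intros)
    then have "((\<lambda>s. p s * d1 s) has_real_derivative A) (at q within {a..1})"
      by (rule has_field_derivative_transform_within[OF _ zero_less_one q]) (simp add: eq[OF a1])
    then show "((\<lambda>s. p s * d1 s) has_real_derivative (if q \<le> 1 then A else d2 q)) (at q within {a..1})"
      using q by simp
  qed (use a in auto)
  also have "\<dots> = sqrt A"
  proof (cases "A = 0")
    case False
    then have "0 < A" using A0 by simp
    then have "h * sqrt a = a * sqrt A"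
      using h by (simp add: a_def real_sqrt_divide power2_eq_square real_div_sqrt field_simps)
    then show ?thesis by (simp add: algebra_simps)
  qed (use A0 in auto)
  finally show ?thesis
    using ALG_eq_maxI[OF alg_functional_le_sqrt a p] by (simp add: A_def a_def p_def)
qed

lemma ALG_threshold_regime:
  assumes h: "h \<ge> 0" and less: "d1 1 + h\<^sup>2 < d2 1"
    and q1: "q1 \<in> {0..<1}" and eq: "d1 q1 + h\<^sup>2 = q1 * d2 q1"
  shows "ALG h \<xi> = ereal (q1 * sqrt (d2 q1) + integral {q1..1} (\<lambda>q. sqrt (d2 q))) \<and>
    ALG_maximized_at h \<xi> (h\<^sup>2 / d2 q1)
      (\<lambda>q. if h\<^sup>2 / d2 q1 = 0 \<and> q1 = 0 then 1
           else if q \<le> q1 then ext_quotient (\<lambda>s. s * d2 q1 - h\<^sup>2) d1 q else 1)"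
proof -
  have d12: "d1 1 < d2 1" using less zero_le_power2[of h] by linarith
  note inc = threshold_increasing[OF d3_pos[OF d12]]
  have pos: "0 < d1 q" "0 < d2 q" if "0 < q" "q < 2" for q
    using degenerate_or_positive that d12 by fastforce+
  define A where "A = d2 q1"
  define a where "a = h\<^sup>2 / A"
  define p where "p = (\<lambda>q. if a = 0 \<and> q1 = 0 then 1
    else if q \<le> q1 then ext_quotient (\<lambda>s. s * A - h\<^sup>2) d1 q else 1)"
  define V where "V = q1 * sqrt A + integral {q1..1} (\<lambda>q. sqrt (d2 q))"
  have "ALG h \<xi> = ereal V \<and> ALG_maximized_at h \<xi> a p"
  proof (cases "h = 0")
    case True
    have q10: "q1 = 0"
    proof (rule ccontr)
      assume "q1 \<noteq> 0"
      then show False using inc[of 0 q1] q1 eq True d1_0 by auto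
    qed
    have a0: "a = 0" using True by (simp add: a_def)
    have p: "p = (\<lambda>_. 1)" by (simp add: p_def a0 q10)
    show ?thesis
    proof (rule ALG_eq_maxI)
      fix q0 f assume f: "q0 \<in> {0..1}" "f \<in> incr_C1 q0 1"
      show "alg_functional h \<xi> q0 f \<le> V"
      proof (rule field_le_epsilon)
        fix e :: real assume e: "0 < e"
        define C where "C = sqrt (d2 1)"
        have C: "0 < C" using pos[of 1] by (simp add: C_def)
        \<comment> \<open>Truncating at \<open>t\<close> costs at most \<open>t * sqrt (d2 t) \<le> t * C\<close>, at most \<open>e\<close> by this choice.\<close>
        define t where "t = min 1 (e / C)"
        have t: "0 < t" "t \<le> 1" "t * C \<le> e"
          using C e by (auto simp: t_def min_def field_simps)
        have d2t: "0 < d2 t" using pos t by auto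
        have "d1 t / sqrt (d2 t) \<le> (t * d2 t) / sqrt (d2 t)"
          using inc[of 0 t] t d1_0 d2t by (intro divide_right_mono) auto
        also have "\<dots> = t * sqrt (d2 t)"
          using real_div_sqrt[of "d2 t"] d2t by (metis less_eq_real_def times_divide_eq_right)
        finally have "d1 t / sqrt (d2 t) \<le> t * sqrt (d2 t)" .
        moreover have "t * sqrt (d2 t) \<le> t * C"
          unfolding C_def using t by (intro mult_left_mono real_sqrt_le_mono d2_mono) auto
        moreover have "integral {t..1} (\<lambda>q. sqrt (d2 q)) \<le> integral {0..1} (\<lambda>q. sqrt (d2 q))"
          using t d2_nonneg
          by (intro integral_subset_le integrable_continuous_real continuous_intros cont_Icc) auto
        moreover have "alg_functional h \<xi> q0 f \<le> (d1 t / sqrt (d2 t) + t * sqrt (d2 t)) / 2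
            + integral {t..1} (\<lambda>q. sqrt (d2 q))"
          using alg_functional_le_truncated[OF f, of t h] t d2t True by simp
        moreover have "V = integral {0..1} (\<lambda>q. sqrt (d2 q))" by (simp add: V_def q10)
        ultimately show "alg_functional h \<xi> q0 f \<le> V + e" using t(3) by argo
      qed
    next
      show "p \<in> incr_C1 a 1"
        unfolding p by (intro mem_incr_C1I[where p' = "\<lambda>_. 0"]) (auto simp: a0)
      have "alg_functional h \<xi> a p
          = h * sqrt a + (0 - a) * sqrt A + integral {0..1} (\<lambda>q. sqrt (d2 q))"
      proof (rule alg_functional_eq)
        fix q :: real assume q: "q \<in> {a..1}"
        have "(if q \<le> 0 then A else d2 q) = d2 q" using q by (auto simp: a0 A_def q10)
        then show "((\<lambda>s. p s * d1 s) has_real_derivative (if q \<le> 0 then A else d2 q)) (at q within {a..1})"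
          using D1[of q] q by (auto simp: p a0 intro: has_field_derivative_at_within)
      qed (auto simp: a0 A_def q10)
      then show "alg_functional h \<xi> a p = V" by (simp add: V_def a0 q10)
    qed (simp add: a0)
  next
    case False
    then have q1pos: "0 < q1" using eq q1 d1_0 by (cases "q1 = 0") auto
    have Apos: "0 < A" using pos q1 q1pos by (simp add: A_def)
    have apos: "0 < a" using False Apos by (simp add: a_def)
    have aA: "a * A = h\<^sup>2" using Apos by (simp add: a_def)
    have "a * A \<le> q1 * A" using aA eq d1_nonneg[of q1] q1 by (simp add: A_def)
    then have aq1: "a \<le> q1" using Apos by simp
    have a01: "a \<in> {0..1}" "a < 1" using apos aq1 q1 by auto
    define f where "f = (\<lambda>q. (q * A - h\<^sup>2) / d1 q)"
    define f' where "f' = (\<lambda>q. (A * d1 q - (q * A - h\<^sup>2) * d2 q) / (d1 q)\<^sup>2)"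
    have pq: "p q = (if q \<in> {a..q1} then f q else 1)" if "q \<in> {a..1}" for q
      using that apos pos(1)[of q] by (auto simp: p_def ext_quotient_def f_def)
    have fq1: "f q1 = 1" using eq pos(1)[of q1] q1 q1pos by (simp add: f_def A_def)
    have num_q1: "A * d1 q1 - (q1 * A - h\<^sup>2) * d2 q1 = 0"
    proof -
      have "q1 * A - h\<^sup>2 = d1 q1" using eq by (simp add: A_def)
      then show ?thesis by (simp only:) (simp add: A_def)
    qed
    then have f'q1: "f' q1 = 0" by (simp add: f'_def)
    have Df: "(f has_real_derivative f' q) (at q within S)" if "q \<in> {a..1}" for q S
      unfolding f_def f'_def using that pos(1)[of q] apos
      by (intro has_field_derivative_at_within[OF linear_path_derivative]) auto
    \<comment> \<open>The two pieces of \<open>p\<close> agree to first order at \<open>q1\<close>, by \<open>fq1\<close> and \<open>f'q1\<close>.\<close>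
    define p' where "p' = (\<lambda>q. if q \<in> {a..q1} then f' q else 0)"
    have un: "{a..1} = {a..q1} \<union> {q1..1}" using aq1 q1 by auto
    have Dp: "(p has_real_derivative p' q) (at q within {a..1})" if q: "q \<in> {a..1}" for q
    proof (rule has_field_derivative_transform_within[OF _ zero_less_one q])
      show "((\<lambda>q. if q \<in> {a..q1} then f q else 1) has_real_derivative p' q) (at q within {a..1})"
        unfolding p'_def has_real_derivative_iff_has_vector_derivative
      proof (rule has_vector_derivative_If_within_closures[OF _ un])
        show "q \<in> {a..q1} \<union> {q1..1}" using q un by simp
      qed (use q aq1 q1 fq1 f'q1 Df in
          \<open>auto simp flip: has_real_derivative_iff_has_vector_derivative\<close>)
    qed (simp add: pq)
    have contp': "continuous_on {a..1} p'"
      unfolding p'_def un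
    proof (rule continuous_on_cases)
      have "d1 q \<noteq> 0" if "q \<in> {a..q1}" for q using pos(1)[of q] that apos q1 by auto
      then show "continuous_on {a..q1} f'"
        unfolding f'_def using apos q1 by (intro continuous_intros cont_Icc) auto
    qed (use f'q1 in auto)
    show ?thesis
    proof (rule ALG_eq_maxI)
      show "a \<in> {0..1}" by fact
      show "p \<in> incr_C1 a 1"
      proof (rule mem_incr_C1I[OF _ Dp contp'])
        fix q assume q: "q \<in> {a..1}"
        show "0 \<le> p' q"
        proof (cases "q \<le> q1")
          case True
          have "0 \<le> A * d1 q - (q * A - h\<^sup>2) * d2 q"
            using num_q1 numerator_antimono[of q q1 "h\<^sup>2" A] q q1 True apos aA Apos
              mult_right_mono[of a q A] by auto
          then show ?thesis using True q by (simp add: p'_def f'_def)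
        qed (simp add: p'_def)
      qed (use a01 aq1 aA pq[of a] pq[of 1] q1 in \<open>auto simp: f_def\<close>)
      have "alg_functional h \<xi> a p
          = h * sqrt a + (q1 - a) * sqrt A + integral {q1..1} (\<lambda>q. sqrt (d2 q))"
      proof (rule alg_functional_eq)
        fix q :: real assume q: "q \<in> {a..1}"
        have "((\<lambda>s. p s * d1 s) has_real_derivative p' q * d1 q + d2 q * p q) (at q within {a..1})"
          using q apos by (intro DERIV_mult Dp has_field_derivative_at_within[OF D1]) auto
        moreover have "f' q * d1 q + d2 q * f q = A"
          using pos(1)[of q] q apos
          by (simp add: f'_def f_def power2_eq_square divide_simps)
        then have "p' q * d1 q + d2 q * p q = (if q \<le> q1 then A else d2 q)"
          using q by (auto simp: p'_def pq)
        ultimately show "((\<lambda>s. p s * d1 s) has_real_derivative (if q \<le> q1 then A else d2 q))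
            (at q within {a..1})" by simp
      qed (use a01 aq1 q1 in \<open>auto simp: A_def\<close>)
      moreover have "h * sqrt a = a * sqrt A"
        using h Apos by (simp add: a_def real_sqrt_divide power2_eq_square real_div_sqrt field_simps)
      ultimately show "alg_functional h \<xi> a p = V" by (simp add: V_def algebra_simps)
      fix q0 g assume g: "q0 \<in> {0..1}" "g \<in> incr_C1 q0 1"
      have "(h\<^sup>2 + d1 q1) / sqrt (d2 q1) = q1 * (d2 q1 / sqrt (d2 q1))"
        using eq by (simp add: add.commute)
      also have "\<dots> = q1 * sqrt A" using Apos by (simp add: A_def real_div_sqrt)
      finally show "alg_functional h \<xi> q0 g \<le> V"
        using alg_functional_le_truncated[OF g, of q1 h] q1 Apos by (simp add: V_def A_def)
    qed
  qed
  then show ?thesis unfolding V_def p_def a_def A_def .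
qed

end

section \<open>Mixtures as power series\<close>

lemma power_series_deriv:
  fixes c :: "nat \<Rightarrow> real"
  assumes "\<And>x. \<bar>x\<bar> < K \<Longrightarrow> summable (\<lambda>n. c n * x ^ n)" "\<bar>x\<bar> < K"
  shows "((\<lambda>x. \<Sum>n. c n * x ^ n) has_real_derivative (\<Sum>n. diffs c n * x ^ n)) (at x)"
    and "summable (\<lambda>n. diffs c n * x ^ n)"
  using termdiffs_strong'[of K c x] termdiff_converges[of x K c] assms by auto

lemma power_series_zero_or_pos:
  fixes c :: "nat \<Rightarrow> real"
  assumes "\<And>x. \<bar>x\<bar> < K \<Longrightarrow> summable (\<lambda>n. c n * x ^ n)" "\<And>n. c n \<ge> 0"
  shows "(\<forall>x\<in>{0<..<K}. (\<Sum>n. c n * x ^ n) > 0) \<or> (\<forall>x\<in>{0<..<K}. (\<Sum>n. c n * x ^ n) = 0)"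
proof (cases "\<exists>n. c n \<noteq> 0")
  case True
  then obtain n where "c n > 0" using assms(2) by (metis less_eq_real_def)
  then have "\<forall>x\<in>{0<..<K}. (\<Sum>n. c n * x ^ n) > 0"
    using assms by (intro ballI suminf_pos2[where i = n]) auto
  then show ?thesis ..
qed auto

text \<open>
  Summability of \<open>2 ^ k * \<gamma> k\<close> bounds the coefficients \<open>(\<gamma> k)\<^sup>2\<close> by \<open>(2 ^ k * \<gamma> k) / 4 ^ k\<close> for large
  \<open>k\<close>, so that the series converges on a disc larger than needed; radius \<open>2\<close> suffices.
\<close>

lemma mixture_derivatives_mixture:
  fixes \<gamma> :: "nat \<Rightarrow> real"
  assumes nonneg: "\<And>k. k \<ge> 2 \<Longrightarrow> \<gamma> k \<ge> 0"
    and summ: "summable (\<lambda>k. 2 ^ (k + 2) * \<gamma> (k + 2))"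
  shows "mixture_derivatives (mixture \<gamma>)"
proof -
  define c where "c = (\<lambda>n. if n < 2 then 0 else (\<gamma> n)\<^sup>2)"
  define S where "S = (\<lambda>(c :: nat \<Rightarrow> real) x :: real. \<Sum>n. c n * x ^ n)"
  have c0: "c n \<ge> 0" for n by (simp add: c_def)
  have sum0: "summable (\<lambda>n. c n * x ^ n)" if x: "\<bar>x\<bar> < 2" for x
  proof -
    have "(\<lambda>k. 2 ^ (k + 2) * \<gamma> (k + 2)) \<longlonglongrightarrow> 0"
      using summ by (rule summable_LIMSEQ_zero)
    then have "\<forall>\<^sub>F k in sequentially. 2 ^ (k + 2) * \<gamma> (k + 2) < 1"
      by (rule order_tendstoD) simp
    then have "\<forall>\<^sub>F k in sequentially. norm (c (k + 2) * x ^ (k + 2)) \<le> 2 ^ (k + 2) * \<gamma> (k + 2)"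
    proof eventually_elim
      case (elim k)
      define g where "g = 2 ^ (k + 2) * \<gamma> (k + 2)"
      have g: "0 \<le> g" "g < 1" using elim nonneg[of "k + 2"] by (auto simp: g_def)
      have "norm (c (k + 2) * x ^ (k + 2)) = (\<gamma> (k + 2))\<^sup>2 * \<bar>x\<bar> ^ (k + 2)"
        by (simp add: c_def abs_mult power_abs)
      also have "\<dots> \<le> (\<gamma> (k + 2))\<^sup>2 * 4 ^ (k + 2)"
        using x by (intro mult_left_mono power_mono) auto
      also have "(4::real) ^ (k + 2) = (2 ^ (k + 2))\<^sup>2"
        by (simp add: power2_eq_square flip: power_mult_distrib)
      also have "(\<gamma> (k + 2))\<^sup>2 * (2 ^ (k + 2))\<^sup>2 = g * g"
        by (simp only: g_def power2_eq_square ac_simps)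
      also have "\<dots> \<le> g" using g by (intro mult_left_le) auto
      finally show ?case by (simp add: g_def)
    qed
    then have "summable (\<lambda>k. c (k + 2) * x ^ (k + 2))"
      by (rule summable_comparison_test_ev[OF _ summ])
    then show ?thesis by (subst (asm) summable_iff_shift)
  qed
  note pd = power_series_deriv[of 2]
  have sum1: "summable (\<lambda>n. diffs c n * x ^ n)" if "\<bar>x\<bar> < 2" for x
    by (rule pd(2)[OF sum0 that])
  have sum2: "summable (\<lambda>n. diffs (diffs c) n * x ^ n)" if "\<bar>x\<bar> < 2" for x
    by (rule pd(2)[OF sum1 that])
  have sum3: "summable (\<lambda>n. diffs (diffs (diffs c)) n * x ^ n)" if "\<bar>x\<bar> < 2" for x
    by (rule pd(2)[OF sum2 that])
  have mix: "mixture \<gamma> x = S c x" if "\<bar>x\<bar> < 2" for x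
    using suminf_split_initial_segment[OF sum0[OF that], of 2]
    by (simp add: S_def mixture_def c_def lessThan_Suc numeral_2_eq_2)
  have step: "(f has_real_derivative S (diffs b) x) (at x)" "deriv f x = S (diffs b) x"
    if f: "\<And>x. \<bar>x\<bar> < 2 \<Longrightarrow> f x = S b x"
      and s: "\<And>x. \<bar>x\<bar> < 2 \<Longrightarrow> summable (\<lambda>n. b n * x ^ n)" and x: "\<bar>x\<bar> < 2" for f b x
  proof -
    have "(S b has_real_derivative S (diffs b) x) (at x)"
      unfolding S_def by (rule pd(1)[OF s x])
    then show "(f has_real_derivative S (diffs b) x) (at x)"
      by (rule has_field_derivative_transform_within_open[where S = "{-2<..<2}"])
        (use f x in auto)
    then show "deriv f x = S (diffs b) x" by (rule DERIV_imp_deriv)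
  qed
  have e1: "deriv (mixture \<gamma>) x = S (diffs c) x" if "\<bar>x\<bar> < 2" for x
    using mix sum0 that by (rule step(2))
  have e2: "deriv (deriv (mixture \<gamma>)) x = S (diffs (diffs c)) x" if "\<bar>x\<bar> < 2" for x
    using e1 sum1 that by (rule step(2))
  have e3: "deriv (deriv (deriv (mixture \<gamma>))) x = S (diffs (diffs (diffs c))) x" if "\<bar>x\<bar> < 2" for x
    using e2 sum2 that by (rule step(2))
  have S0: "S b 0 = b 0" for b
    by (simp add: S_def powser_zero)
  show ?thesis
  proof
    fix q :: real assume "0 \<le> q" "q < 2"
    then have q: "\<bar>q\<bar> < 2" by simp
    show "(deriv (mixture \<gamma>) has_real_derivative deriv (deriv (mixture \<gamma>)) q) (at q)"
      unfolding e2[OF q] by (rule step(1)[OF e1 sum1 q])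
    show "(deriv (deriv (mixture \<gamma>)) has_real_derivative deriv (deriv (deriv (mixture \<gamma>))) q) (at q)"
      unfolding e3[OF q] by (rule step(1)[OF e2 sum2 q])
  next
    show "deriv (mixture \<gamma>) 0 = 0"
      using e1[of 0] S0[of "diffs c"] by (simp add: diffs_def c_def)
    show "0 \<le> deriv (deriv (mixture \<gamma>)) 0"
      using e2[of 0] S0[of "diffs (diffs c)"] by (simp add: diffs_def c_def)
    have "diffs (diffs (diffs c)) n \<ge> 0" for n
      using c0 by (simp add: diffs_def)
    then have "(\<forall>q\<in>{0<..<2}. S (diffs (diffs (diffs c))) q > 0) \<or>
        (\<forall>q\<in>{0<..<2}. S (diffs (diffs (diffs c))) q = 0)"
      unfolding S_def by (intro power_series_zero_or_pos sum3)
    then show "(\<forall>q\<in>{0<..<2}. deriv (deriv (deriv (mixture \<gamma>))) q > 0) \<or>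
        (\<forall>q\<in>{0<..<2}. deriv (deriv (deriv (mixture \<gamma>))) q = 0)"
      using e3 by simp
  qed
qed

section \<open>The optimal value and path\<close>

theorem corollary1p8:
  fixes \<gamma> :: "nat \<Rightarrow> real" and h :: real and \<xi> :: "real \<Rightarrow> real"
  assumes gamma_nonneg: "\<And>k. k \<ge> 2 \<Longrightarrow> \<gamma> k \<ge> 0"
    and gamma_summable: "summable (\<lambda>k. 2 ^ (k + 2) * \<gamma> (k + 2))"
    and xi: "\<xi> = mixture \<gamma>"
    and h_nonneg: "h \<ge> 0"
  shows "(deriv \<xi> 1 + h\<^sup>2 \<ge> deriv (deriv \<xi>) 1 \<longrightarrow>
            ALG h \<xi> = ereal (sqrt (deriv \<xi> 1 + h\<^sup>2)) \<and>
            ALG_maximized_at h \<xi>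
              (h\<^sup>2 / (deriv \<xi> 1 + h\<^sup>2))
              (ext_quotient (\<lambda>q. q * (deriv \<xi> 1 + h\<^sup>2) - h\<^sup>2) (deriv \<xi>)))
       \<and> (\<not> deriv \<xi> 1 + h\<^sup>2 \<ge> deriv (deriv \<xi>) 1 \<longrightarrow>
            (\<exists>!q1. q1 \<in> {0..<1} \<and> deriv \<xi> q1 + h\<^sup>2 = q1 * deriv (deriv \<xi>) q1) \<and>
            (\<forall>q1\<in>{0..<1}. deriv \<xi> q1 + h\<^sup>2 = q1 * deriv (deriv \<xi>) q1 \<longrightarrow>
               ALG h \<xi> = ereal (q1 * sqrt (deriv (deriv \<xi>) q1) +
                                 integral {q1..1} (\<lambda>q. sqrt (deriv (deriv \<xi>) q))) \<and>
               (let q0 = h\<^sup>2 / deriv (deriv \<xi>) q1 in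
                ALG_maximized_at h \<xi> q0
                  (\<lambda>q. if q0 = 0 \<and> q1 = 0 then 1
                        else if q \<le> q1
                        then ext_quotient (\<lambda>s. s * deriv (deriv \<xi>) q1 - h\<^sup>2) (deriv \<xi>) q
                        else 1))))"
proof -
  interpret mixture_derivatives \<xi>
    unfolding xi using gamma_nonneg gamma_summable by (rule mixture_derivatives_mixture)
  show ?thesis
    using ALG_linear_regime[OF h_nonneg] ex1_threshold[of h] ALG_threshold_regime[OF h_nonneg]
    unfolding Let_def not_le by blast
qed

end
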